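(* Let $\{\mathcal{T}(t)\}_{t\ge 0}$ be the symmetric telegraph process with speed $c>0$ and rate $\lambda>0$, and let $t>0$. For every integer $k\ge 0$ and $0<\beta<ct$, $$P\Bigl\{ \max_{0\le s\le t} \mathcal{T}(s) < \beta \,\Big|\, V(0) = -c,\ N(t) = 2k+1\Bigr\} = \frac{\beta}{ct} \sum_{j=0}^{k-1} \Bigl( \frac{c^2t^2-\beta^2}{c^2t^2}\Bigr)^j \frac{1}{2^{2j}}\binom{2j}{j} + \frac{(2k)!}{k!(k+1)!}\,\frac{(c^2t^2-\beta^2)^k }{2(2ct)^{2k}}\Bigl(\frac{\beta}{ct} +(2k+1) \Bigr) ,$$ where the sum is empty (equal to $0$) when $k=0$.
   Context: Let $c>0$, $\lambda>0$. Let $V(0)$ be a random variable with $P\{V(0)=c\}=P\{V(0)=-c\}=\tfrac12$ and let $\{N(t)\}_{t\ge0}$ be a homogeneous Poisson process with rate $\lambda$, independent of $V(0)$. The symmetric telegraph process is $\mathcal{T}(t)=\int_0^t V(0)(-1)^{N(s)}\,ds$, $t\ge 0$ (so $\mathcal{T}(0)=0$). *)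

theory Defs
  imports "HOL-Probability.Probability"
begin

text \<open>
  Homogeneous Poisson process. The path properties are required of every outcome (not just almost
  every one), so that path functionals such as running maxima are random variables even when
  \<open>M\<close> is not complete. Increments are taken in type \<^typ>\<open>nat\<close>; as paths are
  nondecreasing, the subtraction never truncates. Only times \<open>t \<ge> 0\<close> matter.
\<close>

locale poisson_process = prob_space M
  for M :: "'a measure" +
  fixes N :: "real \<Rightarrow> 'a \<Rightarrow> nat" and rate :: real
  assumes rate_pos: "rate > 0"
    and measurable_N: "\<And>t. t \<ge> 0 \<Longrightarrow> N t \<in> measurable M (count_space UNIV)"
    and N_zero: "\<And>\<omega>. \<omega> \<in> space M \<Longrightarrow> N 0 \<omega> = 0"
    and N_mono: "\<And>\<omega> s t. \<omega> \<in> space M \<Longrightarrow> 0 \<le> s \<Longrightarrow> s \<le> t \<Longrightarrow> N s \<omega> \<le> N t \<omega>"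
    and N_right_continuous:
      "\<And>\<omega> t. \<omega> \<in> space M \<Longrightarrow> t \<ge> 0 \<Longrightarrow> continuous (at_right t) (\<lambda>s. N s \<omega>)"
    and independent_increments:
      "\<And>(n::nat) (\<tau> :: nat \<Rightarrow> real). 0 \<le> \<tau> 0 \<Longrightarrow> (\<And>i. i < n \<Longrightarrow> \<tau> i < \<tau> (Suc i)) \<Longrightarrow>
         indep_vars (\<lambda>_. count_space UNIV) (\<lambda>i \<omega>. N (\<tau> (Suc i)) \<omega> - N (\<tau> i) \<omega>) {..<n}"
    and poisson_increments:
      "\<And>s t. 0 \<le> s \<Longrightarrow> s < t \<Longrightarrow>
         distr M (count_space UNIV) (\<lambda>\<omega>. N t \<omega> - N s \<omega>) = measure_pmf (poisson_pmf (rate * (t - s)))"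

text \<open>
  \<open>V0\<close> is independent of the process \<open>N\<close> as a whole: the events generated by
  \<open>V0\<close> are independent of the \<open>\<sigma>\<close>-algebra generated by all \<open>N t\<close>,
  \<open>t \<ge> 0\<close>. (The library's \<open>indep_var\<close> needs both variables to have the same type.)
\<close>

locale symmetric_telegraph = poisson_process M N rate
  for M :: "'a measure" and V0 :: "'a \<Rightarrow> real" and N :: "real \<Rightarrow> 'a \<Rightarrow> nat"
    and c :: real and rate :: real +
  assumes c_pos: "c > 0"
    and measurable_V0: "V0 \<in> borel_measurable M"
    and prob_V0_plus: "prob {\<omega> \<in> space M. V0 \<omega> = c} = 1 / 2"
    and prob_V0_minus: "prob {\<omega> \<in> space M. V0 \<omega> = - c} = 1 / 2"
    and indep_V0_N:
      "indep_set {V0 -` A \<inter> space M | A. A \<in> sets borel}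
         (sigma_sets (space M) {N t -` A \<inter> space M | t A. t \<ge> 0})"

definition telegraph :: "('a \<Rightarrow> real) \<Rightarrow> (real \<Rightarrow> 'a \<Rightarrow> nat) \<Rightarrow> real \<Rightarrow> 'a \<Rightarrow> real"
  where "telegraph V0 N t \<omega> = integral {0..t} (\<lambda>s. V0 \<omega> * (-1) ^ N s \<omega>)"

text \<open>
  Running maximum. Paths of the telegraph process are continuous, so on \<open>[0, t]\<close> the
  supremum is attained and is the maximum.
\<close>

definition running_max :: "(real \<Rightarrow> 'a \<Rightarrow> real) \<Rightarrow> real \<Rightarrow> 'a \<Rightarrow> real"
  where "running_max X t \<omega> = (SUP s\<in>{0..t}. X s \<omega>)"

end

theory Submission
  imports Defs
begin

text \<open>
  Cut \<open>[0, t]\<close> into \<open>m\<close> cells and freeze the velocity on each cell. Given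
  \<open>N t = n\<close>, the cells containing a jump form, up to a vanishing probability, a uniformly
  chosen \<open>n\<close>-subset of the \<open>m\<close> cells, so the problem is to count the subsets whose walk
  stays below a barrier \<open>b\<close>. In the coordinates \<open>m = x + y\<close>, \<open>b = x - y\<close>
  a down step lowers \<open>y\<close> and an up step lowers \<open>x\<close>, and the first-step recursion is
  Pascal's rule for the signed Vandermonde sum
  \<open>\<Sum>j\<le>n. sgn (n + s - 2 j) (x choose (n - j)) (y choose j)\<close>, with
  \<open>s = 1\<close> for walks starting downwards and \<open>s = 0\<close> for walks starting upwards.
  As \<open>m\<close> grows, the conditional probability becomes the expectation of
  \<open>sgn (n + 1 - 2 X)\<close> for \<open>X\<close> binomial with parameters \<open>n\<close> and
  \<open>q = (1 - \<beta> / (c t)) / 2\<close>. For odd \<open>n\<close> this is evaluated by adding two trials at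
  a time: \<open>sgn (n - 2 X)\<close> changes in expectation only through the central binomial term.
\<close>

section \<open>Counting walks below a barrier\<close>

text \<open>
  The entries of the list are the numbers of jumps in successive cells; \<open>up\<close> is the current
  direction and \<open>b\<close> the distance to the barrier. The barrier is tested only while the
  walk moves upwards, including after its last step; with this convention the first-step recursion
  has no boundary corrections and the count is exact.
\<close>

fun admissible :: "bool \<Rightarrow> int \<Rightarrow> nat list \<Rightarrow> bool" where
  "admissible up b [] \<longleftrightarrow> (up \<longrightarrow> 0 < b)"
| "admissible up b (k # ks) \<longleftrightarrow> (up \<longrightarrow> 0 < b) \<and>
     admissible (up \<noteq> odd k) (if up then b - 1 else b + 1) ks"

text \<open>Unrolls the recursion into one test per prefix, ready for comparison with a sampled
  path. The step of cell \<open>i\<close> uses the parity of the jumps in earlier cells only: the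
  velocity is frozen at the left end of the cell.\<close>

lemma admissible_iff:
  "admissible up b ks \<longleftrightarrow> (\<forall>j\<le>length ks. up \<noteq> odd (sum_list (take j ks)) \<longrightarrow>
     (\<Sum>i<j. if up \<noteq> odd (sum_list (take i ks)) then 1 else - 1) < b)"
proof (induction ks arbitrary: up b)
  case Nil
  then show ?case by simp
next
  case (Cons k ks)
  have all: "(\<forall>j\<le>Suc m. P j) \<longleftrightarrow> P 0 \<and> (\<forall>j\<le>m. P (Suc j))" for m and P :: "nat \<Rightarrow> bool"
    by (metis Suc_le_mono bot_nat_0.extremum not0_implies_Suc)
  have flip: "(up \<noteq> odd (k + a)) \<longleftrightarrow> ((up \<noteq> odd k) \<noteq> odd a)" for a
    by auto
  show ?case
    by (simp only: list.size(4) add_Suc_right add_0_right all admissible.simps(2) Cons.IH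
        sum.lessThan_Suc_shift take_Suc_Cons sum_list.Cons flip)
      (auto simp: algebra_simps)
qed

definition jump_patterns :: "bool \<Rightarrow> nat \<Rightarrow> nat \<Rightarrow> int \<Rightarrow> nat list set" where
  "jump_patterns up m n b =
     {ks. length ks = m \<and> set ks \<subseteq> {0, 1} \<and> sum_list ks = n \<and> admissible up b ks}"

lemma finite_jump_patterns: "finite (jump_patterns up m n b)"
  by (rule finite_subset[OF _ finite_lists_length_eq[of "{0, 1}" m]]) (auto simp: jump_patterns_def)

lemma jump_patterns_0: "(up \<longrightarrow> 0 < b) \<Longrightarrow> jump_patterns up 0 n b = (if n = 0 then {[]} else {})"
  by (auto simp: jump_patterns_def)

lemma jump_patterns_Suc:
  assumes "up \<longrightarrow> 0 < b"
  shows "jump_patterns up (Suc m) n b =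
    (#) 0 ` jump_patterns up m n (if up then b - 1 else b + 1) \<union>
    (if n = 0 then {} else (#) 1 ` jump_patterns (\<not> up) m (n - 1) (if up then b - 1 else b + 1))"
    (is "?L = ?R")
proof (rule set_eqI)
  fix ks
  show "ks \<in> ?L \<longleftrightarrow> ks \<in> ?R"
  proof (cases ks)
    case Nil
    then show ?thesis by (auto simp: jump_patterns_def)
  next
    case (Cons k ks')
    show ?thesis
      using assms unfolding Cons by (cases n) (auto simp: jump_patterns_def)
  qed
qed

lemma card_jump_patterns_Suc:
  assumes "up \<longrightarrow> 0 < b"
  shows "card (jump_patterns up (Suc m) n b) =
    card (jump_patterns up m n (if up then b - 1 else b + 1)) +
    (if n = 0 then 0 else card (jump_patterns (\<not> up) m (n - 1) (if up then b - 1 else b + 1)))"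
  unfolding jump_patterns_Suc[OF assms]
  by (subst card_Un_disjoint) (auto simp: finite_jump_patterns card_image)

text \<open>The barrier is too far away for any test to fail. A walk starting downwards may have
  \<open>b = m\<close>, because its first step gains room. This supplies the boundary case
  \<open>y = 0\<close> of the exact count.\<close>

lemma card_jump_patterns_unconstrained:
  "(up \<longrightarrow> int m < b) \<Longrightarrow> int m \<le> b \<Longrightarrow> card (jump_patterns up m n b) = m choose n"
proof (induction m arbitrary: up n b)
  case 0
  then show ?case by (auto simp: jump_patterns_0)
next
  case (Suc m)
  then have "up \<longrightarrow> 0 < b" by auto
  from card_jump_patterns_Suc[OF this, of m n] Suc show ?case
    by (cases n) auto
qed

section \<open>Signed Vandermonde sums and the exact count\<close>

definition sgn_vandermonde :: "int \<Rightarrow> nat \<Rightarrow> nat \<Rightarrow> nat \<Rightarrow> int" where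
  "sgn_vandermonde s n x y =
     (\<Sum>j\<le>n. sgn (int n + s - 2 * int j) * int (x choose (n - j)) * int (y choose j))"

text \<open>Pascal's rule in \<open>x\<close>: the signs for \<open>Suc n\<close> with
  \<open>s = 0\<close> are those for \<open>n\<close> with \<open>s = 1\<close>. The last index
  carries \<open>x choose 0\<close>, which does not depend on \<open>x\<close>.\<close>

lemma sgn_vandermonde_Suc_left:
  "sgn_vandermonde 0 (Suc n) (Suc x) y = sgn_vandermonde 0 (Suc n) x y + sgn_vandermonde 1 n x y"
proof -
  have "sgn_vandermonde 0 (Suc n) (Suc x) y =
      (\<Sum>j\<le>n. sgn (int n + 1 - 2 * int j) * (int (x choose (Suc n - j)) + int (x choose (n - j)))
         * int (y choose j)) + sgn (int (Suc n) - 2 * int (Suc n)) * int (y choose Suc n)"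
    unfolding sgn_vandermonde_def sum.atMost_Suc
    by (intro arg_cong2[where f = "(+)"] sum.cong) (auto simp: Suc_diff_le algebra_simps)
  then show ?thesis
    by (simp add: sgn_vandermonde_def sum.distrib algebra_simps)
qed

text \<open>Pascal's rule in \<open>y\<close>: shifting \<open>j\<close> by one subtracts 2 inside
  the sign, which turns \<open>Suc n\<close> with \<open>s = 1\<close> into \<open>n\<close> with
  \<open>s = 0\<close>.\<close>

lemma sgn_vandermonde_Suc_right:
  "sgn_vandermonde 1 (Suc n) x (Suc y) = sgn_vandermonde 1 (Suc n) x y + sgn_vandermonde 0 n x y"
  unfolding sgn_vandermonde_def sum.atMost_Suc_shift
  by (simp add: sum.distrib algebra_simps)

text \<open>The reflection of \<open>j\<close> to \<open>n - j\<close> swaps the two binomials and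
  negates the sign.\<close>

lemma sgn_vandermonde_diag: "sgn_vandermonde 0 n x x = 0"
proof -
  have "sgn_vandermonde 0 n x x = - sgn_vandermonde 0 n x x"
    unfolding sgn_vandermonde_def
    by (subst sum_negf[symmetric], rule sum.reindex_bij_witness[of _ "\<lambda>j. n - j" "\<lambda>j. n - j"])
      (auto simp: sgn_if of_nat_diff)
  then show ?thesis by simp
qed

lemma sgn_vandermonde_0_right: "sgn_vandermonde 1 n x 0 = int (x choose n)"
proof -
  have "sgn_vandermonde 1 n x 0 = (\<Sum>j\<in>{0}. sgn (int n + 1 - 2 * int j) * int (x choose (n - j)) * int (0 choose j))"
    unfolding sgn_vandermonde_def by (rule sum.mono_neutral_right) auto
  then show ?thesis by simp
qed

lemma sgn_vandermonde_0: "sgn_vandermonde s 0 x y = sgn s"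
  by (simp add: sgn_vandermonde_def)

text \<open>At \<open>x = y\<close> an upward walk fails at once, matching the antisymmetric sum; at
  \<open>y = 0\<close> a downward walk is unconstrained. In the other cases the first step preserves
  \<open>y \<le> x\<close>, and both sides obey the same recursion.\<close>

lemma card_jump_patterns:
  "y \<le> x \<Longrightarrow> int (card (jump_patterns up (x + y) n (int x - int y))) =
     sgn_vandermonde (if up then 0 else 1) n x y"
proof (induction "x + y" arbitrary: up x y n rule: less_induct)
  case less
  consider "up" "x = y" | x' where "up" "x = Suc x'" "y \<le> x'" | "\<not> up" "y = 0"
    | y' where "\<not> up" "y = Suc y'"
    using less.prems by (cases y; cases x) (auto simp: le_less less_Suc_eq)
  then show ?case
  proof cases
    case 1
    have "\<not> admissible True 0 ks" for ks by (cases ks) auto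
    then show ?thesis using 1 by (auto simp: jump_patterns_def sgn_vandermonde_diag)
  next
    case 2
    have "up \<longrightarrow> 0 < int x - int y" using 2 by auto
    from card_jump_patterns_Suc[OF this, of "x' + y" n] 2 less.hyps[of x' y] show ?thesis
      by (cases n) (simp_all add: sgn_vandermonde_Suc_left sgn_vandermonde_0 algebra_simps)
  next
    case 3
    then show ?thesis by (simp add: card_jump_patterns_unconstrained sgn_vandermonde_0_right)
  next
    case 4
    have "up \<longrightarrow> 0 < int x - int y" using 4 by auto
    from card_jump_patterns_Suc[OF this, of "x + y'" n] 4 less.hyps[of x y'] less.prems show ?thesis
      by (cases n) (simp_all add: sgn_vandermonde_Suc_right sgn_vandermonde_0 algebra_simps)
  qed
qed

section \<open>Signed binomial sums\<close>

text \<open>The coefficient is a falling factorial of \<open>i\<close> factors over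
  \<open>fact i\<close>; after scaling, the offsets \<open>l / m\<close> vanish.\<close>

lemma tendsto_binomial_over_power:
  fixes x :: "nat \<Rightarrow> nat"
  assumes "(\<lambda>m. real (x m) / real m) \<longlonglongrightarrow> a"
  shows "(\<lambda>m. real (x m choose i) / real m ^ i) \<longlonglongrightarrow> a ^ i / fact i"
proof -
  have "real (x m choose i) / real m ^ i =
      (\<Prod>l<i. real (x m) / real m - real l / real m) / fact i" for m
    by (simp add: binomial_gbinomial gbinomial_prod_rev prod_dividef lessThan_atLeast0
        flip: diff_divide_distrib)
  moreover have "(\<lambda>m. (\<Prod>l<i. real (x m) / real m - real l / real m) / fact i)
      \<longlonglongrightarrow> (\<Prod>l<i. a - 0) / fact i"
    by (intro tendsto_intros assms lim_const_over_n) auto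
  ultimately show ?thesis by simp
qed

section \<open>Expected signs of binomial variables\<close>

definition sgn_binomial :: "int \<Rightarrow> nat \<Rightarrow> real \<Rightarrow> real" where
  "sgn_binomial s n q =
     (\<Sum>j\<le>n. sgn (real n + of_int s - 2 * real j) * real (n choose j) * (1 - q) ^ (n - j) * q ^ j)"

text \<open>Choosing \<open>n\<close> cells without replacement becomes choosing with replacement:
  for fixed \<open>n\<close> the hypergeometric weights tend to binomial ones.\<close>

lemma tendsto_sgn_vandermonde:
  fixes y :: "nat \<Rightarrow> nat"
  assumes "(\<lambda>m. real (y m) / real m) \<longlonglongrightarrow> q" and "\<forall>\<^sub>F m in sequentially. y m \<le> m"
  shows "(\<lambda>m. fact n * of_int (sgn_vandermonde s n (m - y m) (y m)) / real m ^ n)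
    \<longlonglongrightarrow> sgn_binomial s n q"
proof -
  have "(\<lambda>m. 1 - real (y m) / real m) \<longlonglongrightarrow> 1 - q"
    by (intro tendsto_intros assms)
  moreover have "\<forall>\<^sub>F m in sequentially. 1 - real (y m) / real m = real (m - y m) / real m"
    using assms(2) eventually_gt_at_top[of 0]
    by eventually_elim (simp add: of_nat_diff field_simps)
  ultimately have x: "(\<lambda>m. real (m - y m) / real m) \<longlonglongrightarrow> 1 - q"
    by (rule Lim_transform_eventually)
  have sgn: "real_of_int (sgn i) = sgn (real_of_int i)" for i by (simp add: sgn_if)
  have "(\<lambda>m. \<Sum>j\<le>n. fact n * sgn (real n + of_int s - 2 * real j) *
       (real ((m - y m) choose (n - j)) / real m ^ (n - j)) * (real (y m choose j) / real m ^ j))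
     \<longlonglongrightarrow> (\<Sum>j\<le>n. fact n * sgn (real n + of_int s - 2 * real j) *
       ((1 - q) ^ (n - j) / fact (n - j)) * (q ^ j / fact j))"
    by (intro tendsto_intros tendsto_binomial_over_power x assms)
  also have "(\<Sum>j\<le>n. fact n * sgn (real n + of_int s - 2 * real j) *
       ((1 - q) ^ (n - j) / fact (n - j)) * (q ^ j / fact j)) = sgn_binomial s n q"
    unfolding sgn_binomial_def by (intro sum.cong) (auto simp: binomial_fact field_simps)
  also have "(\<lambda>m. \<Sum>j\<le>n. fact n * sgn (real n + of_int s - 2 * real j) *
       (real ((m - y m) choose (n - j)) / real m ^ (n - j)) * (real (y m choose j) / real m ^ j)) =
    (\<lambda>m. fact n * of_int (sgn_vandermonde s n (m - y m) (y m)) / real m ^ n)"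
    by (rule ext) (auto simp: sgn_vandermonde_def sum_distrib_left sum_divide_distrib sgn
        simp flip: power_add intro!: sum.cong)
  finally show ?thesis .
qed

text \<open>Conditioning on one extra trial: a failure raises the offset \<open>s\<close> by one, a
  success lowers it by one.\<close>

lemma sgn_binomial_Suc:
  "sgn_binomial s (Suc n) q = (1 - q) * sgn_binomial (s + 1) n q + q * sgn_binomial (s - 1) n q"
proof -
  define T where "T s j = sgn (real (Suc n) + of_int s - 2 * real j)" for s :: int and j
  have "sgn_binomial s (Suc n) q = (\<Sum>j\<le>Suc n. T s j * real (n choose j) * (1 - q) ^ (Suc n - j) * q ^ j)
     + (\<Sum>j\<le>n. T s (Suc j) * real (n choose j) * (1 - q) ^ (n - j) * q ^ Suc j)"
    unfolding sgn_binomial_def sum.atMost_Suc_shift T_def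
    by (simp add: algebra_simps sum.distrib)
  also have "(\<Sum>j\<le>Suc n. T s j * real (n choose j) * (1 - q) ^ (Suc n - j) * q ^ j) =
      (1 - q) * sgn_binomial (s + 1) n q"
    unfolding sgn_binomial_def sum_distrib_left sum.atMost_Suc[of _ n]
    by (intro trans[OF arg_cong2[where f = "(+)", OF sum.cong[OF refl] _] add_0_right])
      (auto simp: T_def Suc_diff_le algebra_simps)
  also have "(\<Sum>j\<le>n. T s (Suc j) * real (n choose j) * (1 - q) ^ (n - j) * q ^ Suc j) =
      q * sgn_binomial (s - 1) n q"
    unfolding sgn_binomial_def sum_distrib_left
    by (intro sum.cong) (auto simp: T_def algebra_simps)
  finally show ?thesis .
qed

text \<open>If a change of offset alters the sign by \<open>d\<close> at the single value
  \<open>i\<close>, the expectation moves by \<open>d\<close> times the binomial probability of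
  \<open>i\<close>.\<close>

lemma sgn_binomial_shift:
  assumes "i \<le> n" and "\<And>j. j \<le> n \<Longrightarrow> sgn (real n + of_int s' - 2 * real j) =
    sgn (real n + of_int s - 2 * real j) + (if j = i then d else 0)"
  shows "sgn_binomial s' n q = sgn_binomial s n q + d * real (n choose i) * (1 - q) ^ (n - i) * q ^ i"
proof -
  have "sgn_binomial s' n q = (\<Sum>j\<le>n. sgn (real n + of_int s - 2 * real j) * real (n choose j) * (1 - q) ^ (n - j) * q ^ j
     + (if j = i then d * real (n choose i) * (1 - q) ^ (n - i) * q ^ i else 0))"
    unfolding sgn_binomial_def
  proof (intro sum.cong refl)
    fix j assume "j \<in> {..n}"
    then show "sgn (real n + of_int s' - 2 * real j) * real (n choose j) * (1 - q) ^ (n - j) * q ^ j =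
      sgn (real n + of_int s - 2 * real j) * real (n choose j) * (1 - q) ^ (n - j) * q ^ j
       + (if j = i then d * real (n choose i) * (1 - q) ^ (n - i) * q ^ i else 0)"
      by (cases "j = i") (simp_all only: assms(2) atMost_iff, simp_all add: algebra_simps)
  qed
  then show ?thesis using assms(1)
    by (simp add: sum.distrib sgn_binomial_def)
qed

text \<open>Condition on the last trial. Among \<open>2 * k\<close> trials the offsets 1 and -1
  alter the sign only at \<open>k\<close>, by 1 and -1, with weights \<open>1 - q\<close> and
  \<open>q\<close>.\<close>

lemma sgn_binomial_odd_0:
  "sgn_binomial 0 (2 * k + 1) q =
     sgn_binomial 0 (2 * k) q + (1 - 2 * q) * real ((2 * k) choose k) * (q * (1 - q)) ^ k"
proof -
  have 1: "sgn_binomial 1 (2 * k) q =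
      sgn_binomial 0 (2 * k) q + 1 * real ((2 * k) choose k) * (1 - q) ^ (2 * k - k) * q ^ k"
    by (rule sgn_binomial_shift) (auto simp: sgn_if)
  have 2: "sgn_binomial (- 1) (2 * k) q =
      sgn_binomial 0 (2 * k) q + (- 1) * real ((2 * k) choose k) * (1 - q) ^ (2 * k - k) * q ^ k"
    by (rule sgn_binomial_shift) (auto simp: sgn_if)
  show ?thesis
    using sgn_binomial_Suc[of 0 "2 * k" q] 1 2 by (simp add: power_mult_distrib) (simp add: algebra_simps)
qed

text \<open>Raising the offset to 1 turns the sign at \<open>k + 1\<close> from -1 into 0 and leaves
  all others alone.\<close>

lemma sgn_binomial_odd_1:
  "sgn_binomial 1 (2 * k + 1) q =
     sgn_binomial 0 (2 * k + 1) q + real ((2 * k + 1) choose k) * q * (q * (1 - q)) ^ k"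
proof -
  have "sgn_binomial 1 (2 * k + 1) q = sgn_binomial 0 (2 * k + 1) q
      + 1 * real ((2 * k + 1) choose (k + 1)) * (1 - q) ^ (2 * k + 1 - (k + 1)) * q ^ (k + 1)"
  proof (rule sgn_binomial_shift)
    fix j assume "j \<le> 2 * k + 1"
    \<comment> \<open>The signs are compared over the reals, so the integrality of \<open>j\<close>
      has to be supplied.\<close>
    have "real j \<le> real k \<or> j = k + 1 \<or> real j \<ge> real k + 2" by linarith
    then show "sgn (real (2 * k + 1) + of_int 1 - 2 * real j) =
        sgn (real (2 * k + 1) + of_int 0 - 2 * real j) + (if j = k + 1 then 1 else 0)"
      by (auto simp: sgn_if)
  qed simp
  moreover have "(2 * k + 1) choose (k + 1) = (2 * k + 1) choose k"
    using binomial_symmetric[of k "2 * k + 1"] by simp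
  ultimately show ?thesis by (simp add: power_mult_distrib)
qed

text \<open>From \<open>2 * k + 1\<close> to \<open>2 * k + 2\<close> trials nothing changes: the
  corrections at \<open>k + 1\<close> and at \<open>k\<close> cancel. Each pair of trials thus
  contributes only the central term of \<open>sgn_binomial_odd_0\<close>.\<close>

lemma sgn_binomial_even_0:
  "sgn_binomial 0 (2 * k) q = (1 - 2 * q) * (\<Sum>j<k. real ((2 * j) choose j) * (q * (1 - q)) ^ j)"
proof (induction k)
  case 0
  then show ?case by (simp add: sgn_binomial_def)
next
  case (Suc k)
  have "sgn_binomial (- 1) (2 * k + 1) q = sgn_binomial 0 (2 * k + 1) q
      + (- 1) * real ((2 * k + 1) choose k) * (1 - q) ^ (2 * k + 1 - k) * q ^ k"
    by (rule sgn_binomial_shift) (auto simp: sgn_if)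
  moreover have "2 * k + 1 - k = Suc k" by simp
  ultimately have m: "sgn_binomial (- 1) (2 * k + 1) q = sgn_binomial 0 (2 * k + 1) q
      - real ((2 * k + 1) choose k) * (1 - q) * (q * (1 - q)) ^ k"
    by (simp add: power_mult_distrib)
  have "sgn_binomial 0 (2 * Suc k) q =
      (1 - q) * sgn_binomial 1 (2 * k + 1) q + q * sgn_binomial (- 1) (2 * k + 1) q"
    using sgn_binomial_Suc[of 0 "2 * k + 1" q] by simp
  also have "\<dots> = sgn_binomial 0 (2 * k + 1) q"
    unfolding m sgn_binomial_odd_1 by (simp add: algebra_simps)
  finally show ?case
    using Suc sgn_binomial_odd_0[of k q] by (simp add: algebra_simps)
qed

lemma sgn_binomial_closed_form:
  fixes a b :: real
  assumes "a \<noteq> 0"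
  shows "sgn_binomial 1 (2 * k + 1) ((1 - b / a) / 2) = b / a *
        (\<Sum>j<k. ((a^2 - b^2) / a^2) ^ j * (1 / 2 ^ (2 * j)) * real ((2 * j) choose j))
      + fact (2 * k) / (fact k * fact (k + 1)) * ((a^2 - b^2) ^ k / (2 * (2 * a) ^ (2 * k)))
        * (b / a + (2 * real k + 1))"
proof -
  define q where "q = (1 - b / a) / 2"
  \<comment> \<open>The Catalan number, of which both binomials below are multiples. The
    coefficients then combine through \<open>(1 - 2 * q) * (k + 1) + (2 * k + 1) * q = (1 - 2 * q +
    (2 * k + 1)) / 2\<close>.\<close>
  define C where "C = (fact (2 * k) / (fact k * fact (k + 1)) :: real)"
  have w: "q * (1 - q) = (a^2 - b^2) / a^2 / 4"
    using assms by (simp add: q_def field_simps power2_eq_square)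
  have r: "b / a = 1 - 2 * q" by (simp add: q_def field_simps)
  have c1: "real ((2 * k) choose k) = (real k + 1) * C"
    by (simp add: C_def binomial_fact del: of_nat_Suc) (simp add: add.commute)
  have c2: "real ((2 * k + 1) choose k) = (2 * real k + 1) * C"
    by (simp add: C_def binomial_fact)
  have e1: "(a^2 - b^2) ^ k / (2 * (2 * a) ^ (2 * k)) = (q * (1 - q)) ^ k / 2"
    unfolding w power_mult by (simp add: power_divide power_mult_distrib)
  have e2: "((a^2 - b^2) / a^2) ^ j * (1 / 2 ^ (2 * j)) = (q * (1 - q)) ^ j" for j
    unfolding w power_mult by (simp add: power_divide)
  show ?thesis
    unfolding q_def[symmetric] C_def[symmetric] e1 e2 sgn_binomial_odd_1 sgn_binomial_odd_0
      sgn_binomial_even_0 c1 c2 r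
    by (simp add: algebra_simps)
qed

section \<open>Discretisation of a single path\<close>

text \<open>Measurability comes from monotonicity: \<open>max 0\<close> extends the path to a
  monotone function on the whole line, and \<open>cos (pi * x)\<close> makes the parity sign a
  continuous function of its value.\<close>

lemma sign_path_integrable:
  fixes f :: "real \<Rightarrow> nat"
  assumes "mono_on {0..} f" and "0 \<le> a"
  shows "(\<lambda>s. (- 1 :: real) ^ f s) integrable_on {a..b}"
proof -
  have "mono (\<lambda>s. real (f (max 0 s)))"
    using assms(1) by (auto intro!: monoI simp: mono_on_def)
  then have [measurable]: "(\<lambda>s. real (f (max 0 s))) \<in> borel_measurable borel"
    by (rule borel_measurable_mono)
  have "(\<lambda>s. cos (pi * real (f (max 0 s)))) \<in> borel_measurable borel"
    by measurable
  then have "(\<lambda>s. cos (pi * real (f (max 0 s)))) \<in> borel_measurable (lebesgue_on {a..b})"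
    by (intro measurable_restrict_space1 measurable_completion) simp
  moreover have "(\<lambda>s. cos (pi * real (f (max 0 s)))) = (\<lambda>s. (- 1) ^ f (max 0 s))"
    by simp
  ultimately have "(\<lambda>s. (- 1 :: real) ^ f (max 0 s)) \<in> borel_measurable (lebesgue_on {a..b})"
    by simp
  then have "(\<lambda>s. (- 1 :: real) ^ f (max 0 s)) integrable_on {a..b}"
    by (rule measurable_bounded_by_integrable_imp_integrable[where g = "\<lambda>_. 1"])
      (auto simp: power_abs)
  then show ?thesis
    by (rule integrable_eq) (use assms(2) in \<open>auto simp: max_def\<close>)
qed

lemma abs_integral_sign_path_le:
  fixes f :: "real \<Rightarrow> nat"
  assumes "mono_on {0..} f" and "0 \<le> a" "a \<le> b"
  shows "\<bar>integral {a..b} (\<lambda>s. (- 1 :: real) ^ f s)\<bar> \<le> b - a"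
proof -
  have "norm (integral {a..b} (\<lambda>s. (- 1 :: real) ^ f s)) \<le> 1 * (b - a)"
    using integrable_bound[of 1 "\<lambda>s. (- 1 :: real) ^ f s" a b]
      sign_path_integrable[OF assms(1,2), of b] assms(3) by (simp add: power_abs)
  then show ?thesis by simp
qed

lemma integral_sign_path_cell:
  fixes f :: "real \<Rightarrow> nat"
  assumes "mono_on {0..} f" and "0 \<le> a" "a \<le> b"
  shows "\<bar>integral {a..b} (\<lambda>s. (- 1 :: real) ^ f s) - (b - a) * (- 1) ^ f a\<bar> \<le>
    2 * (b - a) * (real (f b) - real (f a))"
proof (cases "f b = f a")
  case True
  have "f s = f a" if "s \<in> {a..b}" for s
    using that assms(2,3) mono_onD[OF assms(1), of a s] mono_onD[OF assms(1), of s b] True by simp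
  then have "integral {a..b} (\<lambda>s. (- 1 :: real) ^ f s) = integral {a..b} (\<lambda>s. (- 1) ^ f a)"
    by (intro Henstock_Kurzweil_Integration.integral_cong arg_cong[where f = "\<lambda>k. (- 1) ^ k"])
  then show ?thesis using assms(3) True by simp
next
  case False
  moreover have "f a \<le> f b"
    using assms by (intro mono_onD[OF assms(1)]) auto
  ultimately have "real (f b) - real (f a) \<ge> 1" by linarith
  then have "2 * (b - a) * 1 \<le> 2 * (b - a) * (real (f b) - real (f a))"
    using assms(3) by (intro mult_left_mono) auto
  moreover have "\<bar>(b - a) * (- 1) ^ f a\<bar> = b - a"
    using assms(3) by (simp add: abs_mult power_abs)
  ultimately show ?thesis
    using abs_integral_sign_path_le[OF assms] by (smt (verit))
qed

lemma integral_sign_path_grid: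
  fixes f :: "real \<Rightarrow> nat"
  assumes mono: "mono_on {0..} f" and h: "0 \<le> h"
  shows "\<bar>integral {0..real j * h} (\<lambda>s. (- 1 :: real) ^ f s) - h * (\<Sum>i<j. (- 1) ^ f (real i * h))\<bar> \<le>
    2 * h * (real (f (real j * h)) - real (f 0))"
proof (induction j)
  case 0
  then show ?case by simp
next
  case (Suc j)
  have le: "0 \<le> real j * h" "real j * h \<le> real (Suc j) * h"
    using h by (auto intro: mult_right_mono)
  have "integral {0..real j * h} (\<lambda>s. (- 1 :: real) ^ f s) +
      integral {real j * h..real (Suc j) * h} (\<lambda>s. (- 1 :: real) ^ f s) =
      integral {0..real (Suc j) * h} (\<lambda>s. (- 1 :: real) ^ f s)"
    by (intro Henstock_Kurzweil_Integration.integral_combine le sign_path_integrable mono) simp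
  moreover have "real (Suc j) * h - real j * h = h"
    by (simp add: algebra_simps)
  ultimately show ?case
    using integral_sign_path_cell[OF mono le] Suc by (simp add: algebra_simps)
qed

section \<open>Running maximum of one path against its grid walk\<close>

context
  fixes V :: "'a \<Rightarrow> real" and N :: "real \<Rightarrow> 'a \<Rightarrow> nat" and \<omega> :: 'a and t :: real and m :: nat
  assumes mono: "mono_on {0..} (\<lambda>s. N s \<omega>)" and N_0: "N 0 \<omega> = 0"
    and t: "0 < t" and m: "0 < m"
begin

lemma telegraph_eq: "telegraph V N s \<omega> = V \<omega> * integral {0..s} (\<lambda>s. (- 1) ^ N s \<omega>)"
  by (simp add: telegraph_def)

text \<open>The supremum dominates the values only for a set bounded above; the finite speed gives
  the bound \<open>\<bar>V \<omega>\<bar> * t\<close>.\<close>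

lemma telegraph_le_running_max:
  assumes "s \<in> {0..t}"
  shows "telegraph V N s \<omega> \<le> running_max (telegraph V N) t \<omega>"
  unfolding running_max_def
proof (rule cSUP_upper[OF assms])
  have "telegraph V N s \<omega> \<le> \<bar>V \<omega>\<bar> * t" if "s \<in> {0..t}" for s
  proof -
    have "\<bar>V \<omega>\<bar> * \<bar>integral {0..s} (\<lambda>s. (- 1) ^ N s \<omega>)\<bar> \<le> \<bar>V \<omega>\<bar> * t"
      using abs_integral_sign_path_le[OF mono, of 0 s] that by (intro mult_left_mono) auto
    then show ?thesis by (simp add: telegraph_eq flip: abs_mult)
  qed
  then show "bdd_above ((\<lambda>s. telegraph V N s \<omega>) ` {0..t})" by (rule bdd_aboveI2)
qed

lemma grid_walk_approximates_telegraph: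
  assumes "j \<le> m"
  shows "\<bar>telegraph V N (real j * (t / m)) \<omega> - V \<omega> * (t / m) * (\<Sum>i<j. (- 1) ^ N (real i * (t / m)) \<omega>)\<bar>
    \<le> \<bar>V \<omega>\<bar> * (t / m) * (2 * real (N t \<omega>))"
proof -
  let ?h = "t / real m"
  have "real j * ?h \<le> real m * ?h" using assms t by (intro mult_right_mono) auto
  then have "real j * ?h \<le> t" using m by simp
  then have "real (N (real j * ?h) \<omega>) \<le> real (N t \<omega>)"
    using mono t by (auto simp: mono_on_def)
  then have "2 * ?h * (real (N (real j * ?h) \<omega>)) \<le> 2 * ?h * real (N t \<omega>)"
    using t by (intro mult_left_mono) auto
  then have "\<bar>integral {0..real j * ?h} (\<lambda>s. (- 1) ^ N s \<omega>) - ?h * (\<Sum>i<j. (- 1) ^ N (real i * ?h) \<omega>)\<bar>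
      \<le> 2 * ?h * real (N t \<omega>)"
    using integral_sign_path_grid[OF mono, of ?h j] t N_0 by simp
  then have "\<bar>V \<omega>\<bar> * \<bar>integral {0..real j * ?h} (\<lambda>s. (- 1) ^ N s \<omega>) - ?h * (\<Sum>i<j. (- 1) ^ N (real i * ?h) \<omega>)\<bar>
      \<le> \<bar>V \<omega>\<bar> * (2 * ?h * real (N t \<omega>))"
    by (intro mult_left_mono) auto
  then show ?thesis
    unfolding telegraph_eq abs_mult[symmetric] right_diff_distrib by (simp only: mult_ac)
qed

lemma grid_walk_le_running_max:
  assumes "j \<le> m"
  shows "V \<omega> * (t / m) * (\<Sum>i<j. (- 1) ^ N (real i * (t / m)) \<omega>) \<le>
    running_max (telegraph V N) t \<omega> + \<bar>V \<omega>\<bar> * (t / m) * (2 * real (N t \<omega>))"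
proof -
  have "real j * (t / m) \<le> real m * (t / m)" using assms t by (intro mult_right_mono) auto
  then have "real j * (t / m) \<in> {0..t}" using t m by simp
  from telegraph_le_running_max[OF this] grid_walk_approximates_telegraph[OF assms]
  show ?thesis by linarith
qed

text \<open>Every \<open>s\<close> lies at most one cell to the right of the grid point
  \<open>j\<close>, found by rounding down. The path moves at most
  \<open>\<bar>V \<omega>\<bar> * (t / m)\<close> in between, which accounts for the extra
  1.\<close>

lemma running_max_le_grid_walk:
  assumes "\<And>j. j \<le> m \<Longrightarrow> V \<omega> * (t / m) * (\<Sum>i<j. (- 1) ^ N (real i * (t / m)) \<omega>) \<le> B"
  shows "running_max (telegraph V N) t \<omega> \<le> B + \<bar>V \<omega>\<bar> * (t / m) * (2 * real (N t \<omega>) + 1)"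
  unfolding running_max_def
proof (rule cSUP_least)
  show "{0..t} \<noteq> {}" using t by simp
  fix s assume s: "s \<in> {0..t}"
  let ?h = "t / real m"
  have h: "?h > 0" using t m by simp
  define j where "j = nat \<lfloor>s / ?h\<rfloor>"
  have "real j = of_int \<lfloor>s / ?h\<rfloor>" using s h by (simp add: j_def)
  then have "real j \<le> s / ?h" "s / ?h \<le> real j + 1" by linarith+
  then have js: "real j * ?h \<le> s" "s \<le> real j * ?h + ?h"
    using pos_le_divide_eq[OF h, of "real j" s] pos_divide_le_eq[OF h, of s "real j + 1"]
    by (simp_all add: distrib_right add_divide_distrib)
  have "s / ?h \<le> m" using s h m t by (simp add: field_simps)
  then have "j \<le> m" unfolding j_def by linarith
  have le0: "0 \<le> real j * ?h" using h by (intro mult_nonneg_nonneg) auto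
  have "integral {0..real j * ?h} (\<lambda>s. (- 1 :: real) ^ N s \<omega>) +
      integral {real j * ?h..s} (\<lambda>s. (- 1 :: real) ^ N s \<omega>) = integral {0..s} (\<lambda>s. (- 1 :: real) ^ N s \<omega>)"
    by (intro Henstock_Kurzweil_Integration.integral_combine le0 js sign_path_integrable mono) simp
  then have "telegraph V N s \<omega> = telegraph V N (real j * ?h) \<omega> +
      V \<omega> * integral {real j * ?h..s} (\<lambda>s. (- 1 :: real) ^ N s \<omega>)"
    unfolding telegraph_eq by (metis distrib_left)
  moreover have "\<bar>V \<omega> * integral {real j * ?h..s} (\<lambda>s. (- 1 :: real) ^ N s \<omega>)\<bar> \<le> \<bar>V \<omega>\<bar> * ?h"
    unfolding abs_mult using abs_integral_sign_path_le[OF mono le0 js(1)] js(2)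
    by (intro mult_left_mono) auto
  ultimately show "telegraph V N s \<omega> \<le> B + \<bar>V \<omega>\<bar> * ?h * (2 * real (N t \<omega>) + 1)"
    using grid_walk_approximates_telegraph[OF \<open>j \<le> m\<close>] assms[OF \<open>j \<le> m\<close>]
    by (simp add: algebra_simps)
qed

end

section \<open>Increments of the Poisson process\<close>

definition increments :: "(real \<Rightarrow> 'a \<Rightarrow> nat) \<Rightarrow> nat \<Rightarrow> real \<Rightarrow> 'a \<Rightarrow> nat list" where
  "increments N m h \<omega> = map (\<lambda>i. N (real (Suc i) * h) \<omega> - N (real i * h) \<omega>) [0..<m]"

context poisson_process
begin

lemma mono_on_path: "\<omega> \<in> space M \<Longrightarrow> mono_on {0..} (\<lambda>s. N s \<omega>)"
  by (auto intro!: mono_onI N_mono)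

text \<open>The increments telescope from \<open>N 0 = 0\<close>; monotone paths keep the
  subtraction on naturals from truncating.\<close>

lemma sum_list_take_increments:
  assumes "\<omega> \<in> space M" "0 \<le> h" "j \<le> m"
  shows "sum_list (take j (increments N m h \<omega>)) = N (real j * h) \<omega>"
  using assms(3)
proof (induction j)
  case 0
  then show ?case using N_zero[OF assms(1)] by simp
next
  case (Suc j)
  have "N (real j * h) \<omega> \<le> N (real (Suc j) * h) \<omega>"
    using assms by (intro N_mono mult_right_mono mult_nonneg_nonneg) auto
  then show ?case
    using Suc by (simp add: take_Suc_conv_app_nth increments_def)
qed

lemma sum_list_increments:
  assumes "\<omega> \<in> space M" "0 \<le> h"
  shows "sum_list (increments N m h \<omega>) = N (real m * h) \<omega>"
  using sum_list_take_increments[OF assms, of m m] by (simp add: increments_def)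

text \<open>With entries 0 and 1 the Poisson weights carry no factorial, so the probability depends
  on the number of jumps alone: all patterns with equally many jumps are equally likely.\<close>

lemma prob_increments_eq:
  assumes h: "0 < h" and ks: "set ks \<subseteq> {0, 1}" "length ks = m"
  shows "prob {\<omega> \<in> space M. increments N m h \<omega> = ks} = (rate * h) ^ sum_list ks * exp (- rate * h * m)"
proof -
  let ?X = "\<lambda>i \<omega>. N (real (Suc i) * h) \<omega> - N (real i * h) \<omega>"
  have cell: "0 \<le> real i * h" "real i * h < real (Suc i) * h"
    "real (Suc i) * h - real i * h = h" for i
    using h by (auto intro: mult_strict_right_mono simp: algebra_simps)
  have [measurable]: "N (real i * h) \<in> measurable M (count_space UNIV)" for i
    by (rule measurable_N[OF cell(1)])
  have single: "prob (?X i -` {ks ! i} \<inter> space M) = (rate * h) ^ (ks ! i) * exp (- rate * h)"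
    if "i < m" for i
  proof -
    have "?X i \<in> measurable M (count_space UNIV)"
      by measurable
    then have "prob (?X i -` {ks ! i} \<inter> space M) = measure (distr M (count_space UNIV) (?X i)) {ks ! i}"
      by (simp add: measure_distr)
    also have "\<dots> = pmf (poisson_pmf (rate * h)) (ks ! i)"
      unfolding poisson_increments[OF cell(1,2)] cell(3) by (simp add: measure_pmf_single)
    also have "ks ! i \<in> {0, 1}" using that ks nth_mem by blast
    then have "pmf (poisson_pmf (rate * h)) (ks ! i) = (rate * h) ^ (ks ! i) * exp (- rate * h)"
      using rate_pos h by auto
    finally show ?thesis .
  qed
  show ?thesis
  proof (cases "m = 0")
    \<comment> \<open>The product rule for independent events needs a nonempty index set.\<close>
    case True
    then show ?thesis using ks by (simp add: increments_def prob_space)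
  next
    case False
    have eq: "{\<omega> \<in> space M. increments N m h \<omega> = ks} = (\<Inter>i\<in>{..<m}. ?X i -` {ks ! i} \<inter> space M)"
      using False ks(2) by (auto simp: increments_def list_eq_iff_nth_eq)
    have "prob (\<Inter>i\<in>{..<m}. ?X i -` {ks ! i} \<inter> space M) = (\<Prod>i<m. prob (?X i -` {ks ! i} \<inter> space M))"
    proof (rule indep_varsD)
      show "indep_vars (\<lambda>_. count_space UNIV) ?X {..<m}"
        by (rule independent_increments) (use cell in auto)
    qed (use False in auto)
    also have "(\<Prod>i<m. prob (?X i -` {ks ! i} \<inter> space M)) = (\<Prod>i<m. (rate * h) ^ (ks ! i) * exp (- rate * h))"
      by (intro prod.cong refl single) simp
    also have "\<dots> = (rate * h) ^ sum_list ks * exp (- rate * h * m)"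
      using ks(2) exp_of_nat_mult[of m "- rate * h"]
      by (simp add: prod.distrib power_sum sum_list_sum_nth lessThan_atLeast0 mult.commute)
    finally show ?thesis unfolding eq .
  qed
qed

text \<open>The history of \<open>N\<close> as a measurable space of its own, since independence of
  \<open>V0\<close> holds for exactly these events.\<close>

definition path_sigma :: "'a measure" where
  "path_sigma = sigma (space M) {N t -` A \<inter> space M | t A. t \<ge> 0}"

lemma space_path_sigma [simp]: "space path_sigma = space M"
  unfolding path_sigma_def by (rule space_measure_of) auto

lemma sets_path_sigma: "sets path_sigma = sigma_sets (space M) {N t -` A \<inter> space M | t A. t \<ge> 0}"
  unfolding path_sigma_def by (rule sets_measure_of) auto

lemma measurable_N_path_sigma: "0 \<le> s \<Longrightarrow> N s \<in> measurable path_sigma (count_space UNIV)"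
  by (rule measurableI) (auto simp: sets_path_sigma intro!: sigma_sets.Basic)

lemma sets_path_sigma_subset: "sets path_sigma \<subseteq> events"
  unfolding sets_path_sigma
  by (rule sets.sigma_sets_subset) (auto intro: measurable_sets[OF measurable_N])

lemma increments_measurable:
  assumes "0 \<le> h"
  shows "{\<omega> \<in> space M. increments N m h \<omega> = ks} \<in> sets path_sigma"
proof -
  have [measurable]: "N (real i * h) \<in> measurable path_sigma (count_space UNIV)" for i
    by (rule measurable_N_path_sigma) (use assms in auto)
  have "{\<omega> \<in> space path_sigma. length ks = m \<and>
      (\<forall>i<m. N (real (Suc i) * h) \<omega> - N (real i * h) \<omega> = ks ! i)} \<in> sets path_sigma"
    by measurable
  also have "{\<omega> \<in> space path_sigma. length ks = m \<and>
      (\<forall>i<m. N (real (Suc i) * h) \<omega> - N (real i * h) \<omega> = ks ! i)} =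
      {\<omega> \<in> space M. increments N m h \<omega> = ks}"
    by (auto simp: increments_def list_eq_iff_nth_eq)
  finally show ?thesis .
qed

lemma increments_in_jump_patterns_eq_Union:
  "{\<omega> \<in> space M. increments N m h \<omega> \<in> jump_patterns up m n b} =
    (\<Union>ks\<in>jump_patterns up m n b. {\<omega> \<in> space M. increments N m h \<omega> = ks})"
  by auto

lemma increments_in_jump_patterns_measurable:
  assumes "0 \<le> h"
  shows "{\<omega> \<in> space M. increments N m h \<omega> \<in> jump_patterns up m n b} \<in> sets path_sigma"
  unfolding increments_in_jump_patterns_eq_Union
  by (intro sets.finite_UN finite_jump_patterns increments_measurable assms)

lemma prob_increments_in_jump_patterns:
  assumes h: "0 < h"
  shows "prob {\<omega> \<in> space M. increments N m h \<omega> \<in> jump_patterns up m n b} =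
    real (card (jump_patterns up m n b)) * (rate * h) ^ n * exp (- rate * h * m)"
proof -
  have "prob (\<Union>ks\<in>jump_patterns up m n b. {\<omega> \<in> space M. increments N m h \<omega> = ks}) =
      (\<Sum>ks\<in>jump_patterns up m n b. prob {\<omega> \<in> space M. increments N m h \<omega> = ks})"
  proof (rule finite_measure_finite_Union[OF finite_jump_patterns])
    show "(\<lambda>ks. {\<omega> \<in> space M. increments N m h \<omega> = ks}) ` jump_patterns up m n b \<subseteq> events"
      using sets_path_sigma_subset increments_measurable[OF less_imp_le[OF h]] by blast
  qed (auto simp: disjoint_family_on_def)
  also have "\<dots> = (\<Sum>ks\<in>jump_patterns up m n b. (rate * h) ^ n * exp (- rate * h * m))"
  proof (rule sum.cong[OF refl])
    fix ks assume "ks \<in> jump_patterns up m n b"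
    then have "set ks \<subseteq> {0, 1}" "length ks = m" "sum_list ks = n"
      by (simp_all add: jump_patterns_def)
    then show "prob {\<omega> \<in> space M. increments N m h \<omega> = ks} = (rate * h) ^ n * exp (- rate * h * m)"
      using prob_increments_eq[OF h] by simp
  qed
  finally show ?thesis unfolding increments_in_jump_patterns_eq_Union by simp
qed

lemma prob_N_eq:
  assumes "0 < t"
  shows "prob {\<omega> \<in> space M. N t \<omega> = n} = (rate * t) ^ n / fact n * exp (- rate * t)"
proof -
  note [measurable] = measurable_N[OF order_refl] measurable_N[OF less_imp_le[OF assms]]
  have "(\<lambda>\<omega>. N t \<omega> - N 0 \<omega>) \<in> measurable M (count_space UNIV)"
    by measurable
  then have "prob ((\<lambda>\<omega>. N t \<omega> - N 0 \<omega>) -` {n} \<inter> space M) =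
      measure (distr M (count_space UNIV) (\<lambda>\<omega>. N t \<omega> - N 0 \<omega>)) {n}"
    by (simp add: measure_distr)
  also have "\<dots> = (rate * t) ^ n / fact n * exp (- rate * t)"
    using poisson_increments[of 0 t] assms rate_pos by (simp add: measure_pmf_single)
  also have "(\<lambda>\<omega>. N t \<omega> - N 0 \<omega>) -` {n} \<inter> space M = {\<omega> \<in> space M. N t \<omega> = n}"
    using N_zero by auto
  finally show ?thesis .
qed

end

section \<open>Joint law with the initial velocity, and measurability of the maximum\<close>

context symmetric_telegraph
begin

lemma prob_V0_minus_and:
  assumes "{\<omega> \<in> space M. P \<omega>} \<in> sets path_sigma"
  shows "prob {\<omega> \<in> space M. V0 \<omega> = - c \<and> P \<omega>} = 1 / 2 * prob {\<omega> \<in> space M. P \<omega>}"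
proof -
  have "prob ((V0 -` {- c} \<inter> space M) \<inter> {\<omega> \<in> space M. P \<omega>}) =
      prob (V0 -` {- c} \<inter> space M) * prob {\<omega> \<in> space M. P \<omega>}"
    by (rule indep_setD[OF indep_V0_N _ assms[unfolded sets_path_sigma]]) auto
  moreover have "V0 -` {- c} \<inter> space M = {\<omega> \<in> space M. V0 \<omega> = - c}" by auto
  moreover have "{\<omega> \<in> space M. V0 \<omega> = - c} \<inter> {\<omega> \<in> space M. P \<omega>} = {\<omega> \<in> space M. V0 \<omega> = - c \<and> P \<omega>}"
    by auto
  ultimately show ?thesis using prob_V0_minus by simp
qed

lemma prob_V0_minus_N_eq:
  assumes "0 < t"
  shows "prob {\<omega> \<in> space M. V0 \<omega> = - c \<and> N t \<omega> = n} = (rate * t) ^ n / fact n * exp (- rate * t) / 2"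
proof -
  have "N t -` {n} \<inter> space path_sigma \<in> sets path_sigma"
    using assms by (intro measurable_sets[OF measurable_N_path_sigma]) auto
  then have "{\<omega> \<in> space M. N t \<omega> = n} \<in> sets path_sigma"
    by (simp add: vimage_def Int_def conj_commute)
  from prob_V0_minus_and[OF this] prob_N_eq[OF assms] show ?thesis by simp
qed

text \<open>The Poisson and velocity weights agree on both sides, leaving
  \<open>fact n / m ^ n\<close> times the count. The barrier \<open>m - 2 * y\<close> is
  \<open>x - y\<close> for \<open>x = m - y\<close>, and \<open>2 * y \<le> m\<close> says
  \<open>y \<le> x\<close>.\<close>

lemma prob_V0_minus_increments:
  assumes "0 < t" "0 < m" "2 * y \<le> m"
  shows "prob {\<omega> \<in> space M. V0 \<omega> = - c \<and>
       increments N m (t / m) \<omega> \<in> jump_patterns False m n (int m - 2 * int y)} =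
    prob {\<omega> \<in> space M. V0 \<omega> = - c \<and> N t \<omega> = n} *
      (fact n * of_int (sgn_vandermonde 1 n (m - y) y) / real m ^ n)"
proof -
  have "y \<le> m - y" "m - y + y = m" "int (m - y) - int y = int m - 2 * int y"
    using assms(3) by auto
  then have "real (card (jump_patterns False m n (int m - 2 * int y))) = of_int (sgn_vandermonde 1 n (m - y) y)"
    using card_jump_patterns[of y "m - y" False n] by (metis of_int_of_nat_eq)
  moreover have h: "0 < t / m" using assms by auto
  moreover have "rate * (t / m) * m = rate * t" using assms(2) by simp
  ultimately show ?thesis
    using assms(2)
    unfolding prob_V0_minus_and[OF increments_in_jump_patterns_measurable[OF less_imp_le[OF h]]]
      prob_increments_in_jump_patterns[OF h] prob_V0_minus_N_eq[OF assms(1)]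
    by (simp add: power_mult_distrib power_divide)
qed

text \<open>A supremum over uncountably many times is obtained as a pointwise limit of maxima over
  finite grids, with error at most \<open>?K / Suc m\<close> on either side.\<close>

lemma running_max_measurable:
  assumes t: "0 < t"
  shows "running_max (telegraph V0 N) t \<in> borel_measurable M"
proof (rule borel_measurable_LIMSEQ_real)
  define W where "W m j \<omega> = V0 \<omega> * (t / real m) * (\<Sum>i<j. (- 1) ^ N (real i * (t / real m)) \<omega>)"
    for m j \<omega>
  define D where "D m \<omega> = Max ((\<lambda>j. W (Suc m) j \<omega>) ` {..Suc m})" for m \<omega>
  show "(\<lambda>m. D m \<omega>) \<longlonglongrightarrow> running_max (telegraph V0 N) t \<omega>" if \<omega>: "\<omega> \<in> space M" for \<omega>
  proof (rule real_tendsto_sandwich)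
    let ?R = "running_max (telegraph V0 N) t \<omega>"
    let ?K = "\<bar>V0 \<omega>\<bar> * t * (2 * real (N t \<omega>) + 1)"
    have *: "?K / real (Suc m) = \<bar>V0 \<omega>\<bar> * (t / real (Suc m)) * (2 * real (N t \<omega>) + 1)" for m
      by simp
    have "?R \<le> D m \<omega> + ?K / real (Suc m)" for m
      unfolding * by (rule running_max_le_grid_walk[where V = V0 and N = N, OF mono_on_path[OF \<omega>] N_zero[OF \<omega>] t])
        (auto simp: D_def W_def intro!: Max_ge)
    then show "\<forall>\<^sub>F m in sequentially. ?R - ?K / real (Suc m) \<le> D m \<omega>"
      by (simp add: algebra_simps)
    have "D m \<omega> \<le> ?R + \<bar>V0 \<omega>\<bar> * (t / real (Suc m)) * (2 * real (N t \<omega>))" for m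
      unfolding D_def W_def using grid_walk_le_running_max[where V = V0 and N = N, OF mono_on_path[OF \<omega>] N_zero[OF \<omega>] t, of "Suc m"]
      by (intro Max.boundedI) auto
    moreover have "\<bar>V0 \<omega>\<bar> * (t / real (Suc m)) * (2 * real (N t \<omega>)) \<le> ?K / real (Suc m)" for m
      unfolding * using t by (intro mult_left_mono) auto
    ultimately show "\<forall>\<^sub>F m in sequentially. D m \<omega> \<le> ?R + ?K / real (Suc m)"
      by (meson add_left_mono always_eventually order_trans)
    have lim: "(\<lambda>m. ?K / real (Suc m)) \<longlonglongrightarrow> 0"
      by (rule LIMSEQ_Suc[OF lim_const_over_n])
    show "(\<lambda>m. ?R - ?K / real (Suc m)) \<longlonglongrightarrow> ?R" using tendsto_diff[OF tendsto_const lim] by simp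
    show "(\<lambda>m. ?R + ?K / real (Suc m)) \<longlonglongrightarrow> ?R" using tendsto_add[OF tendsto_const lim] by simp
  qed
  note [measurable] = measurable_V0
  have [measurable]: "N (real i * (t / real m)) \<in> measurable M (count_space UNIV)" for i m
    using t by (intro measurable_N) auto
  have [measurable]: "W m j \<in> borel_measurable M" for m j
    unfolding W_def by measurable
  show "D m \<in> borel_measurable M" for m
    unfolding D_def by (intro borel_measurable_Max) auto
qed

end

section \<open>Passage to the limit\<close>

text \<open>The minus sign stands for \<open>V0 = - c\<close>: the walk moves up exactly while
  \<open>N\<close> is odd. Keeping it integer valued, in units of \<open>c * h\<close>, lets it be
  compared with the combinatorial barrier.\<close>

definition grid_walk :: "(real \<Rightarrow> 'a \<Rightarrow> nat) \<Rightarrow> real \<Rightarrow> 'a \<Rightarrow> nat \<Rightarrow> int" where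
  "grid_walk N h \<omega> j = (\<Sum>i<j. - ((- 1) ^ N (real i * h) \<omega>))"

text \<open>An upward step starts strictly below the integer \<open>b\<close>, so it ends at most at
  \<open>b\<close>; downward steps only decrease. Testing upward times alone therefore controls the
  whole walk.\<close>

lemma grid_walk_le:
  assumes "\<And>i. i \<le> m \<Longrightarrow> odd (N (real i * h) \<omega>) \<Longrightarrow> grid_walk N h \<omega> i < b" and "0 \<le> b" "j \<le> m"
  shows "grid_walk N h \<omega> j \<le> b"
  using assms(3)
proof (induction j)
  case 0
  then show ?case using assms(2) by (simp add: grid_walk_def)
next
  case (Suc j)
  then show ?case using assms(1)[of j]
    by (cases "odd (N (real j * h) \<omega>)") (auto simp: grid_walk_def)
qed

lemma tendsto_over_n_of_bounded_diff:
  fixes y :: "nat \<Rightarrow> nat"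
  assumes "\<forall>\<^sub>F m in sequentially. \<bar>real (y m) - q * real m\<bar> \<le> K"
  shows "(\<lambda>m. real (y m) / real m) \<longlonglongrightarrow> q"
proof -
  have "(\<lambda>m. real (y m) / real m - q) \<longlonglongrightarrow> 0"
  proof (rule Lim_null_comparison[OF _ lim_const_over_n])
    show "\<forall>\<^sub>F m in sequentially. norm (real (y m) / real m - q) \<le> K / real m"
      using assms eventually_gt_at_top[of 0]
    proof eventually_elim
      case (elim m)
      then have "real (y m) / real m - q = (real (y m) - q * real m) / real m"
        by (simp add: field_simps)
      then show ?case using elim by (simp add: divide_right_mono)
    qed
  qed
  then show ?thesis by (simp add: LIM_zero_iff)
qed

lemma (in poisson_process) admissible_increments_iff:
  assumes "\<omega> \<in> space M" "0 \<le> h"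
  shows "admissible False b (increments N m h \<omega>) \<longleftrightarrow>
    (\<forall>j\<le>m. odd (N (real j * h) \<omega>) \<longrightarrow> grid_walk N h \<omega> j < b)"
proof -
  have take: "sum_list (take j (increments N m h \<omega>)) = N (real j * h) \<omega>" if "j \<le> m" for j
    using sum_list_take_increments[OF assms that] .
  have walk: "(\<Sum>i<j. if False \<noteq> odd (sum_list (take i (increments N m h \<omega>))) then 1 else - 1) = grid_walk N h \<omega> j"
    if "j \<le> m" for j
    unfolding grid_walk_def using that by (intro sum.cong) (auto simp: take)
  have "length (increments N m h \<omega>) = m" by (simp add: increments_def)
  then show ?thesis
    unfolding admissible_iff using take walk by (auto cong: conj_cong imp_cong)
qed

context symmetric_telegraph
begin

text \<open>The slack above \<open>b\<close>, in units of \<open>c * (t / m)\<close>, is two per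
  jump for freezing velocities and one for times between grid points.\<close>

lemma running_max_less_of_admissible:
  assumes \<omega>: "\<omega> \<in> space M" "V0 \<omega> = - c" and t: "0 < t" and m: "0 < m" and b: "0 \<le> b"
    and adm: "admissible False b (increments N m (t / m) \<omega>)"
    and less: "c * (t / m) * (of_int b + 2 * real (N t \<omega>) + 1) < \<beta>"
  shows "running_max (telegraph V0 N) t \<omega> < \<beta>"
proof -
  have h: "0 \<le> t / m" using t by simp
  have "V0 \<omega> * (t / m) * (\<Sum>i<j. (- 1) ^ N (real i * (t / m)) \<omega>) \<le> c * (t / m) * of_int b" if "j \<le> m" for j
  proof -
    have "grid_walk N (t / m) \<omega> j \<le> b"
      by (rule grid_walk_le[OF _ b that]) (use adm in \<open>auto simp: admissible_increments_iff[OF \<omega>(1) h]\<close>)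
    then have "c * (t / m) * of_int (grid_walk N (t / m) \<omega> j) \<le> c * (t / m) * of_int b"
      using c_pos h by (intro mult_left_mono mult_nonneg_nonneg of_int_le_iff[THEN iffD2]) auto
    then show ?thesis by (simp add: grid_walk_def \<omega>(2) sum_negf)
  qed
  from running_max_le_grid_walk[where V = V0 and N = N, OF mono_on_path[OF \<omega>(1)] N_zero[OF \<omega>(1)] t m this]
  have "running_max (telegraph V0 N) t \<omega> \<le>
      c * (t / m) * of_int b + c * (t / m) * (2 * real (N t \<omega>) + 1)"
    using \<omega>(2) c_pos by simp
  also have "\<dots> = c * (t / m) * (of_int b + 2 * real (N t \<omega>) + 1)"
    by (simp only: distrib_left add.assoc)
  finally show ?thesis using less by linarith
qed

text \<open>The maximum already covers all grid times, so only the freezing error of two units per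
  jump has to be absorbed.\<close>

lemma admissible_of_running_max_less:
  assumes \<omega>: "\<omega> \<in> space M" "V0 \<omega> = - c" and t: "0 < t" and m: "0 < m"
    and less: "running_max (telegraph V0 N) t \<omega> < \<beta>"
    and le: "\<beta> \<le> c * (t / m) * (of_int b - 2 * real (N t \<omega>))"
  shows "admissible False b (increments N m (t / m) \<omega>)"
proof -
  have h: "0 < t / m" using t m by simp
  have "grid_walk N (t / m) \<omega> j < b" if "j \<le> m" for j
  proof -
    have "c * (t / m) * of_int (grid_walk N (t / m) \<omega> j) =
        V0 \<omega> * (t / m) * (\<Sum>i<j. (- 1) ^ N (real i * (t / m)) \<omega>)"
      by (simp add: grid_walk_def \<omega>(2) sum_negf)
    also have "\<dots> \<le> running_max (telegraph V0 N) t \<omega> + c * (t / m) * (2 * real (N t \<omega>))"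
      using grid_walk_le_running_max[where V = V0 and N = N, OF mono_on_path[OF \<omega>(1)] N_zero[OF \<omega>(1)] t m that]
        \<omega>(2) c_pos by simp
    also have "\<dots> < c * (t / m) * of_int b"
      using less le unfolding right_diff_distrib by linarith
    finally show ?thesis
      using mult_less_cancel_left_pos[OF mult_pos_pos[OF c_pos h]] by simp
  qed
  then show ?thesis
    using admissible_increments_iff[OF \<omega>(1) less_imp_le[OF h]] by blast
qed

text \<open>The event \<open>A\<close> contains \<open>E m (yl m)\<close> and is contained in
  \<open>E m (yu m)\<close> together with \<open>B - E m 0\<close>; both bounds tend to the same
  limit.\<close>

lemma cond_prob_running_max_less:
  assumes t: "0 < t" and \<beta>: "0 < \<beta>" "\<beta> < c * t"
  shows "\<P>(\<omega> in M. running_max (telegraph V0 N) t \<omega> < \<beta> \<bar> V0 \<omega> = - c \<and> N t \<omega> = n) =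
    sgn_binomial 1 n ((1 - \<beta> / (c * t)) / 2)"
proof -
  \<comment> \<open>Chosen so that \<beta>, measured in units of \<open>c * t / m\<close>, equals
    \<open>m - 2 * y\<close> at \<open>y = q * m\<close>.\<close>
  define q where "q = (1 - \<beta> / (c * t)) / 2"
  have ct: "0 < c * t" using c_pos t by simp
  have q: "0 < q" "q < 1 / 2" using \<beta> ct by (simp_all add: q_def field_simps)
  have \<beta>_eq: "\<beta> = c * t * (1 - 2 * q)" using c_pos t by (simp add: q_def field_simps)
  define B where "B = {\<omega> \<in> space M. V0 \<omega> = - c \<and> N t \<omega> = n}"
  define A where "A = {\<omega> \<in> space M. running_max (telegraph V0 N) t \<omega> < \<beta> \<and> V0 \<omega> = - c \<and> N t \<omega> = n}"
  define E where "E m y = {\<omega> \<in> space M. V0 \<omega> = - c \<and>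
      increments N m (t / real m) \<omega> \<in> jump_patterns False m n (int m - 2 * int y)}" for m y
  note [measurable] = measurable_V0 running_max_measurable[OF t] measurable_N[OF less_imp_le[OF t]]
  have ev: "A \<in> events" "B \<in> events"
    unfolding A_def B_def by measurable
  have E_ev: "E m y \<in> events" for m y
  proof -
    have "{\<omega> \<in> space M. V0 \<omega> = - c} \<inter>
        {\<omega> \<in> space M. increments N m (t / real m) \<omega> \<in> jump_patterns False m n (int m - 2 * int y)} \<in> events"
      using increments_in_jump_patterns_measurable[of "t / real m" m False n "int m - 2 * int y"] t
        sets_path_sigma_subset by (intro sets.Int) (auto, measurable)
    also have "{\<omega> \<in> space M. V0 \<omega> = - c} \<inter>
        {\<omega> \<in> space M. increments N m (t / real m) \<omega> \<in> jump_patterns False m n (int m - 2 * int y)} = E m y"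
      by (auto simp: E_def)
    finally show ?thesis .
  qed
  have N_t: "N t \<omega> = n" if "\<omega> \<in> E m y" "0 < m" for \<omega> m y
    using that sum_list_increments[of \<omega> "t / real m" m] t by (auto simp: E_def jump_patterns_def)
  have p_pos: "0 < prob B"
    unfolding B_def prob_V0_minus_N_eq[OF t] using rate_pos t by simp
  \<comment> \<open>Stated for general \<open>q'\<close>, because it is needed at \<open>q\<close>
    and also at 0, for \<open>E m 0\<close>. The bound \<open>q' < 1 / 2\<close> makes the barrier
    eventually nonnegative.\<close>
  have lim: "(\<lambda>m. prob (E m (y m))) \<longlonglongrightarrow> prob B * sgn_binomial 1 n q'"
    if "(\<lambda>m. real (y m) / real m) \<longlonglongrightarrow> q'" "q' < 1 / 2" for y :: "nat \<Rightarrow> nat" and q'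
  proof -
    have half: "\<forall>\<^sub>F m in sequentially. 0 < m \<and> 2 * y m \<le> m"
      using order_tendstoD(2)[OF that] eventually_gt_at_top[of 0]
      by eventually_elim (simp add: field_simps)
    then have "\<forall>\<^sub>F m in sequentially. y m \<le> m" by eventually_elim simp
    from tendsto_mult[OF tendsto_const tendsto_sgn_vandermonde[OF that(1) this]]
    show ?thesis
      by (rule Lim_transform_eventually)
        (use half in \<open>eventually_elim, simp add: E_def B_def prob_V0_minus_increments[OF t]\<close>)
  qed

  \<comment> \<open>Shifting \<open>y = q * m\<close> by about \<open>n\<close> cells in either direction absorbs the
    discretisation error without changing the limit of \<open>y / m\<close>. Outcomes with several jumps in
    one cell are \<open>B - E m 0\<close>, because the barrier \<open>m\<close> is never exceeded in \<open>m\<close> steps.\<close>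
  define yl where "yl m = nat \<lceil>q * real m\<rceil> + n + 1" for m
  have yl: "real (yl m) \<ge> q * real m + n + 1" "real (yl m) \<le> q * real m + n + 2" for m
    using q(1) unfolding yl_def by (auto simp: of_nat_nat) linarith+
  have "\<bar>real (yl m) - q * real m\<bar> \<le> real n + 2" for m
    using yl[of m] by linarith
  then have yl_lim: "(\<lambda>m. real (yl m) / real m) \<longlonglongrightarrow> q"
    by (intro tendsto_over_n_of_bounded_diff always_eventually allI)
  have lower: "prob B * sgn_binomial 1 n q \<le> prob A"
  proof (rule tendsto_upperbound[OF lim[OF yl_lim q(2)]])
    have "\<forall>\<^sub>F m in sequentially. real (yl m) / real m < 1 / 2"
      by (rule order_tendstoD(2)[OF yl_lim q(2)])
    then show "\<forall>\<^sub>F m in sequentially. prob (E m (yl m)) \<le> prob A"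
      using eventually_gt_at_top[of 0]
    proof eventually_elim
      case (elim m)
      have "E m (yl m) \<subseteq> A"
      proof
        fix \<omega> assume E: "\<omega> \<in> E m (yl m)"
        have Nt: "N t \<omega> = n" by (rule N_t[OF E elim(2)])
        \<comment> \<open>The shift by \<open>n + 1\<close> cells lowers the barrier by
          \<open>2 * n + 2\<close>, one more than the slack \<open>2 * n + 1\<close>, hence the
          strict inequality.\<close>
        have "real m - 2 * real (yl m) + 2 * real n + 1 < real m * (1 - 2 * q)"
          using yl(1)[of m] by (simp add: algebra_simps)
        then have "c * (t / m) * (real m - 2 * real (yl m) + 2 * real n + 1) < c * (t / m) * (real m * (1 - 2 * q))"
          using c_pos t elim(2) by (intro mult_strict_left_mono) auto
        then have "c * (t / m) * (real_of_int (int m - 2 * int (yl m)) + 2 * real (N t \<omega>) + 1) < \<beta>"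
          using elim(2) Nt by (simp add: \<beta>_eq)
        moreover have "0 \<le> int m - 2 * int (yl m)" using elim by (simp add: field_simps)
        moreover have "\<omega> \<in> space M" "V0 \<omega> = - c"
            "admissible False (int m - 2 * int (yl m)) (increments N m (t / real m) \<omega>)"
          using E by (simp_all add: E_def jump_patterns_def)
        ultimately have "running_max (telegraph V0 N) t \<omega> < \<beta>"
          using t elim(2) by (metis running_max_less_of_admissible)
        then show "\<omega> \<in> A" using E Nt by (simp add: A_def E_def)
      qed
      then show ?case by (rule finite_measure_mono[OF _ ev(1)])
    qed
  qed simp

  \<comment> \<open>Subtraction on naturals truncates here, so the bounds on \<open>yu\<close> hold
    only once \<open>q * m\<close> has reached \<open>n\<close>.\<close>
  define yu where "yu m = nat \<lfloor>q * real m\<rfloor> - n" for m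
  have yu: "real (yu m) \<le> q * real m - n" "real (yu m) \<ge> q * real m - n - 1" if "n \<le> q * real m" for m
  proof -
    have "int n \<le> \<lfloor>q * real m\<rfloor>" using that by (simp add: le_floor_iff)
    then have "real (yu m) = of_int \<lfloor>q * real m\<rfloor> - real n"
      unfolding yu_def by (simp add: of_nat_diff nat_le_iff le_nat_iff)
    then show "real (yu m) \<le> q * real m - n" "real (yu m) \<ge> q * real m - n - 1" by linarith+
  qed
  have ev_n: "\<forall>\<^sub>F m in sequentially. n \<le> q * real m"
  proof -
    have "\<forall>\<^sub>F m in sequentially. real m \<ge> n / q"
      using filterlim_real_sequentially by (simp add: filterlim_at_top)
    then show ?thesis by eventually_elim (use q(1) in \<open>simp add: field_simps\<close>)
  qed
  have yu_lim: "(\<lambda>m. real (yu m) / real m) \<longlonglongrightarrow> q"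
  proof (rule tendsto_over_n_of_bounded_diff)
    show "\<forall>\<^sub>F m in sequentially. \<bar>real (yu m) - q * real m\<bar> \<le> real n + 1"
      using ev_n
    proof eventually_elim
      case (elim m)
      then show ?case using yu[OF elim] by linarith
    qed
  qed
  have upper: "prob A \<le> prob B * sgn_binomial 1 n q"
  proof (rule tendsto_lowerbound)
    \<comment> \<open>At \<open>q = 0\<close> the binomial variable is 0 and the sign is 1. Hence
      \<open>E m 0\<close> exhausts \<open>B\<close> in the limit: several jumps in one cell become
      negligible.\<close>
    have "sgn_binomial 1 n 0 = (\<Sum>j\<in>{0}. sgn (real n + of_int 1 - 2 * real j) * real (n choose j) * (1 - 0) ^ (n - j) * 0 ^ j)"
      unfolding sgn_binomial_def by (rule sum.mono_neutral_right) auto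
    then have E0: "(\<lambda>m. prob (E m 0)) \<longlonglongrightarrow> prob B"
      using lim[of "\<lambda>_. 0" 0] by simp
    show "(\<lambda>m. prob (E m (yu m)) + (prob B - prob (E m 0))) \<longlonglongrightarrow> prob B * sgn_binomial 1 n q"
      using tendsto_add[OF lim[OF yu_lim q(2)] tendsto_diff[OF tendsto_const[of "prob B"] E0]] by simp
    show "\<forall>\<^sub>F m in sequentially. prob A \<le> prob (E m (yu m)) + (prob B - prob (E m 0))"
      using ev_n eventually_gt_at_top[of 0]
    proof eventually_elim
      case (elim m)
      have EB: "E m 0 \<subseteq> B"
      proof
        fix \<omega> assume "\<omega> \<in> E m 0"
        with N_t[OF this elim(2)] show "\<omega> \<in> B" by (simp add: B_def E_def)
      qed
      have "A \<subseteq> E m (yu m) \<union> (B - E m 0)"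
      proof
        fix \<omega> assume A: "\<omega> \<in> A"
        then have "\<omega> \<in> B" by (simp add: A_def B_def)
        \<comment> \<open>Membership in \<open>E m 0\<close> already gives entries 0 and 1 with sum
          \<open>n\<close>, so only admissibility at the lower barrier remains.\<close>
        moreover have "\<omega> \<in> E m (yu m)" if "\<omega> \<in> E m 0"
        proof -
          have "real m * (1 - 2 * q) \<le> real m - 2 * real (yu m) - 2 * real n"
            using yu(1)[OF elim(1)] by (simp add: algebra_simps)
          then have "c * (t / m) * (real m * (1 - 2 * q)) \<le> c * (t / m) * (real m - 2 * real (yu m) - 2 * real n)"
            using c_pos t elim(2) by (intro mult_left_mono) auto
          then have "\<beta> \<le> c * (t / m) * (real_of_int (int m - 2 * int (yu m)) - 2 * real (N t \<omega>))"
            using elim(2) A by (simp add: \<beta>_eq A_def)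
          then have "admissible False (int m - 2 * int (yu m)) (increments N m (t / m) \<omega>)"
            using A by (intro admissible_of_running_max_less[OF _ _ t elim(2)]) (auto simp: A_def)
          then show ?thesis using that by (simp add: E_def jump_patterns_def)
        qed
        ultimately show "\<omega> \<in> E m (yu m) \<union> (B - E m 0)" by blast
      qed
      then have "prob A \<le> prob (E m (yu m) \<union> (B - E m 0))"
        using ev E_ev by (intro finite_measure_mono) auto
      also have "\<dots> \<le> prob (E m (yu m)) + prob (B - E m 0)"
        using ev E_ev by (intro measure_Un_le) auto
      also have "prob (B - E m 0) = prob B - prob (E m 0)"
        using ev E_ev EB by (intro finite_measure_Diff) auto
      finally show ?case .
    qed
  qed simp

  have "prob A / prob B = sgn_binomial 1 n q"
    using lower upper p_pos by (simp add: field_simps)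
  then show ?thesis
    by (simp add: cond_prob_def A_def B_def q_def)
qed

end

theorem corollary5p3:
  fixes M :: "'a measure" and V0 :: "'a \<Rightarrow> real" and N :: "real \<Rightarrow> 'a \<Rightarrow> nat"
    and c rate t \<beta> :: real and k :: nat
  assumes "symmetric_telegraph M V0 N c rate"
    and "c > 0" and "rate > 0" and "t > 0"
    and "0 < \<beta>" and "\<beta> < c * t"
  shows "\<P>(\<omega> in M. running_max (telegraph V0 N) t \<omega> < \<beta> \<bar> V0 \<omega> = - c \<and> N t \<omega> = 2 * k + 1)
    = \<beta> / (c * t) *
        (\<Sum>j<k. ((c^2 * t^2 - \<beta>^2) / (c^2 * t^2)) ^ j * (1 / 2 ^ (2 * j)) * real ((2 * j) choose j))
      + fact (2 * k) / (fact k * fact (k + 1)) * ((c^2 * t^2 - \<beta>^2) ^ k / (2 * (2 * c * t) ^ (2 * k)))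
        * (\<beta> / (c * t) + (2 * real k + 1))"
proof -
  interpret symmetric_telegraph M V0 N c rate by fact
  have "c * t \<noteq> 0" using assms by simp
  \<comment> \<open>Applied with \<open>a = c * t\<close> and \<open>b = \<beta>\<close>, for
    \<open>2 * k + 1\<close> jumps.\<close>
  from sgn_binomial_closed_form[OF this, of k \<beta>] show ?thesis
    unfolding cond_prob_running_max_less[OF assms(4-6)] by (simp only: power_mult_distrib mult.assoc)
qed

end
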